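(* For every integer $d\ge 2$ there exists a constant $c_d>0$, depending only on $d$, such that for every $n\ge 2$ of the form $n=n_1^d$ with $n_1\in\mathbb{N}$, \[ \inf_{\tilde\theta_n}\ \sup_{\theta_0\in\mathcal{M}(\mathbb{L}_{d,n})\cap B_\infty(1)} R(\tilde\theta_n,\theta_0)\ge c_d n^{-1/d}, \] where the infimum is taken over all estimators $\tilde\theta_n=\tilde\theta_n(Y)$ of $\theta_0$, i.e. all measurable functions of the data $Y$ with values in $\mathbb{R}^{\mathbb{L}_{d,n}}$.
   Context: For $n=n_1^d$, $\mathbb{L}_{d,n}:=\{1,\ldots,n_1\}^d$, partially ordered by $u\preceq v$ iff $u_j\le v_j$ for all $j$. $\mathcal{M}(\mathbb{L}_{d,n}):=\{\theta\in\mathbb{R}^{\mathbb{L}_{d,n}}:\theta_u\le\theta_v\text{ whenever }u\preceq v\}$. $B_\infty(1)$ is the set of vectors with all entries of absolute value at most $1$. One observes $Y=(Y_w)_{w\in\mathbb{L}_{d,n}}$ with $Y_w=(\theta_0)_w+\epsilon_w$, where the $\epsilon_w$ are independent $N(0,1)$. The risk is $R(\tilde\theta_n,\theta_0):=\mathbb{E}\bigl[\frac1n\|\tilde\theta_n(Y)-\theta_0\|_2^2\bigr]$, expectation under signal $\theta_0$. *)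

theory Defs
  imports "HOL-Probability.Probability"
begin

text \<open>
  Points of the lattice are functions on the coordinate set \<open>{1..d}\<close>, and real vectors indexed
  by the lattice are functions on the lattice; both are extensional, i.e. \<open>undefined\<close> off
  their index set.
\<close>

definition lattice :: "nat \<Rightarrow> nat \<Rightarrow> (nat \<Rightarrow> nat) set" where
  "lattice d n1 = {1..d} \<rightarrow>\<^sub>E {1..n1}"

definition coord_le :: "nat \<Rightarrow> (nat \<Rightarrow> nat) \<Rightarrow> (nat \<Rightarrow> nat) \<Rightarrow> bool" where
  "coord_le d u v \<longleftrightarrow> (\<forall>j\<in>{1..d}. u j \<le> v j)"

definition monotone_signals :: "nat \<Rightarrow> nat \<Rightarrow> ((nat \<Rightarrow> nat) \<Rightarrow> real) set" where
  "monotone_signals d n1 =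
    {\<theta> \<in> lattice d n1 \<rightarrow>\<^sub>E UNIV.
      \<forall>u\<in>lattice d n1. \<forall>v\<in>lattice d n1. coord_le d u v \<longrightarrow> \<theta> u \<le> \<theta> v}"

definition sup_ball :: "nat \<Rightarrow> nat \<Rightarrow> real \<Rightarrow> ((nat \<Rightarrow> nat) \<Rightarrow> real) set" where
  "sup_ball d n1 r = {\<theta> \<in> lattice d n1 \<rightarrow>\<^sub>E UNIV. \<forall>w\<in>lattice d n1. \<bar>\<theta> w\<bar> \<le> r}"

definition data_space :: "nat \<Rightarrow> nat \<Rightarrow> ((nat \<Rightarrow> nat) \<Rightarrow> real) measure" where
  "data_space d n1 = (\<Pi>\<^sub>M w\<in>lattice d n1. borel)"

definition noise :: "nat \<Rightarrow> nat \<Rightarrow> ((nat \<Rightarrow> nat) \<Rightarrow> real) measure" where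
  "noise d n1 = (\<Pi>\<^sub>M w\<in>lattice d n1. std_normal_distribution)"

definition observation ::
  "nat \<Rightarrow> nat \<Rightarrow> ((nat \<Rightarrow> nat) \<Rightarrow> real) \<Rightarrow> ((nat \<Rightarrow> nat) \<Rightarrow> real) \<Rightarrow> (nat \<Rightarrow> nat) \<Rightarrow> real" where
  "observation d n1 \<theta> \<epsilon> = (\<lambda>w\<in>lattice d n1. \<theta> w + \<epsilon> w)"

definition estimators ::
  "nat \<Rightarrow> nat \<Rightarrow> (((nat \<Rightarrow> nat) \<Rightarrow> real) \<Rightarrow> ((nat \<Rightarrow> nat) \<Rightarrow> real)) set" where
  "estimators d n1 = data_space d n1 \<rightarrow>\<^sub>M data_space d n1"

text \<open>
  The loss is nonnegative but need not be integrable for an arbitrary estimator, so the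
  expectation is taken in \<open>[0,\<infinity>]\<close>. A Bochner integral would assign risk 0 to
  estimators of infinite risk.
\<close>

definition risk ::
  "nat \<Rightarrow> nat \<Rightarrow> (((nat \<Rightarrow> nat) \<Rightarrow> real) \<Rightarrow> ((nat \<Rightarrow> nat) \<Rightarrow> real)) \<Rightarrow>
    ((nat \<Rightarrow> nat) \<Rightarrow> real) \<Rightarrow> ennreal" where
  "risk d n1 T \<theta> =
    (\<integral>\<^sup>+\<epsilon>. ennreal (1 / real (n1 ^ d) *
      (L2_set (\<lambda>w. T (observation d n1 \<theta> \<epsilon>) w - \<theta> w) (lattice d n1))\<^sup>2) \<partial>noise d n1)"

end

theory Submission
  imports Defs
begin

text \<open>
  The lattice contains antichains of about \<open>n\<^sub>1 ^ (d - 1)\<close> points, and monotonicity says nothing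
  about how a signal varies within an antichain. Points with the same coordinate sum
  form an antichain, and only about \<open>d * n\<^sub>1\<close> sums occur, so by pigeonhole some layer of
  constant sum has at least \<open>n\<^sub>1 ^ (d - 1) / d\<close> points (\<open>large_layer\<close>). Put \<open>-1\<close> below this layer,
  \<open>1\<close> above it, and an arbitrary sign at every point of the layer: each of the resulting signals is
  monotone and bounded by 1 (\<open>step_signal_monotone\<close>).

  On this cube of signals, no estimator can do well at the points of the layer. Two signals that
  differ only at \<open>w\<close> are told apart by \<open>Y w\<close> alone, which is \<open>N(-1,1)\<close> under one and
  \<open>N(1,1)\<close> under the other. These laws overlap, so the squared errors at \<open>w\<close> under the
  two signals add up to at least an absolute constant (\<open>coord_risk_two_point\<close>). Averaging over
  the cube makes the bounds for all \<open>w\<close> hold simultaneously (\<open>assouad_average\<close>): the worst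
  total error on the layer is at least proportional to its size. Dividing by \<open>n = n\<^sub>1 ^ d\<close>
  leaves a constant multiple of \<open>1 / n\<^sub>1 = n powr (- 1 / d)\<close>.
\<close>

section \<open>Averaging over a cube of signals\<close>

text \<open>
  This is the combinatorial half of Assouad's lemma. Flipping the membership of \<open>w\<close> permutes the
  subsets of \<open>W\<close> and matches them in pairs whose two values of \<open>r w\<close> sum to at least \<open>c\<close>. Hence
  the average of \<open>r w\<close> over all subsets is at least \<open>c / 2\<close>, and by linearity the average of the sum
  over \<open>w\<close> is at least \<open>card W * c / 2\<close>.
\<close>

lemma assouad_average:
  fixes r :: "'a \<Rightarrow> 'a set \<Rightarrow> ennreal"
  assumes fin: "finite W"
    and pair: "\<And>w A. w \<in> W \<Longrightarrow> A \<subseteq> W - {w} \<Longrightarrow> c \<le> r w A + r w (insert w A)"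
    and bound: "\<And>A. A \<subseteq> W \<Longrightarrow> (\<Sum>w\<in>W. r w A) \<le> S"
  shows "of_nat (card W) * c \<le> 2 * S"
proof -
  define N :: ennreal where "N = of_nat (card (Pow W))"
  have N: "N \<noteq> 0" "N \<noteq> \<top>"
    by (simp_all add: N_def fin card_Pow ennreal_of_nat_eq_real_of_nat)
  have coord: "N * c \<le> 2 * (\<Sum>A\<in>Pow W. r w A)" if w: "w \<in> W" for w
  proof -
    define flip where "flip A = (if w \<in> A then A - {w} else insert w A)" for A
    have flip: "bij_betw flip (Pow W) (Pow W)"
      by (rule bij_betw_byWitness[where f' = flip]) (use w in \<open>auto simp: flip_def\<close>)
    have "N * c \<le> (\<Sum>A\<in>Pow W. r w A + r w (flip A))"
      unfolding N_def
    proof (rule sum_bounded_below)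
      fix A assume A: "A \<in> Pow W"
      show "c \<le> r w A + r w (flip A)"
      proof (cases "w \<in> A")
        case True
        then have "insert w (A - {w}) = A" by blast
        then show ?thesis
          using pair[OF w, of "A - {w}"] A True by (auto simp: flip_def add.commute)
      next
        case False
        then show ?thesis
          using pair[OF w, of A] A by (auto simp: flip_def)
      qed
    qed
    also have "\<dots> = 2 * (\<Sum>A\<in>Pow W. r w A)"
      by (simp add: sum.distrib sum.reindex_bij_betw[OF flip, of "r w"] mult_2)
    finally show ?thesis .
  qed
  have "N * (of_nat (card W) * c) = of_nat (card W) * (N * c)"
    by (simp add: mult_ac)
  also have "\<dots> \<le> (\<Sum>w\<in>W. 2 * (\<Sum>A\<in>Pow W. r w A))"
    by (rule sum_bounded_below) (rule coord)
  also have "\<dots> = 2 * (\<Sum>A\<in>Pow W. \<Sum>w\<in>W. r w A)"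
    by (subst sum.swap) (simp add: sum_distrib_left)
  also have "\<dots> \<le> 2 * (N * S)"
    unfolding N_def by (intro mult_left_mono sum_bounded_above) (auto intro: bound)
  also have "\<dots> = N * (2 * S)"
    by (simp add: mult_ac)
  finally show ?thesis
    using N by (simp add: ennreal_mult_le_mult_iff)
qed

section \<open>Two Gaussian shifts in one coordinate\<close>

lemma nn_integral_std_normal_shift:
  assumes [measurable]: "h \<in> borel_measurable borel"
  shows "(\<integral>\<^sup>+e. h (a + e) \<partial>std_normal_distribution) =
    (\<integral>\<^sup>+z. ennreal (std_normal_density (z - a)) * h z \<partial>lborel)"
proof -
  have "(\<integral>\<^sup>+e. h (a + e) \<partial>std_normal_distribution) =
      (\<integral>\<^sup>+e. ennreal (std_normal_density e) * h (a + e) \<partial>lborel)"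
    by (subst nn_integral_density) auto
  also have "\<dots> = (\<integral>\<^sup>+z. ennreal (std_normal_density (z - a)) * h z \<partial>lborel)"
    by (subst (2) nn_integral_real_affine[where c = 1 and t = a]) auto
  finally show ?thesis .
qed

lemma std_normal_density_ge:
  assumes "\<bar>z\<bar> \<le> b"
  shows "std_normal_density b \<le> std_normal_density z"
proof -
  have "z\<^sup>2 \<le> b\<^sup>2"
    using assms by (metis abs_le_square_iff abs_of_nonneg abs_ge_zero order_trans)
  then show ?thesis
    by (simp add: std_normal_density_def divide_right_mono)
qed

text \<open>
  An estimate \<open>g\<close> of the mean from one observation cannot be close to both \<open>-1\<close> and \<open>1\<close>:
  pointwise, the two squared errors sum to at least 2. On \<open>[-1,1]\<close>, an interval of length 2,
  both candidate densities are at least the standard normal density at 2, because no point of it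
  is further than 2 from either mean.
\<close>

lemma two_point_normal:
  fixes g :: "real \<Rightarrow> real"
  assumes [measurable]: "g \<in> borel_measurable borel"
  shows "ennreal (4 * std_normal_density 2) \<le>
    (\<integral>\<^sup>+e. ennreal ((g (-1 + e) - (-1))\<^sup>2) \<partial>std_normal_distribution) +
    (\<integral>\<^sup>+e. ennreal ((g (1 + e) - 1)\<^sup>2) \<partial>std_normal_distribution)"
proof -
  let ?k = "std_normal_density 2"
  have shift: "(\<integral>\<^sup>+e. ennreal ((g (a + e) - a)\<^sup>2) \<partial>std_normal_distribution) =
      (\<integral>\<^sup>+z. ennreal (std_normal_density (z - a)) * ennreal ((g z - a)\<^sup>2) \<partial>lborel)" for a
    by (rule nn_integral_std_normal_shift[of "\<lambda>z. ennreal ((g z - a)\<^sup>2)" a]) simp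
  have "ennreal (4 * ?k) = (\<integral>\<^sup>+z. ennreal (2 * ?k) * indicator {-1..1::real} z \<partial>lborel)"
    by (simp add: nn_integral_cmult_indicator flip: ennreal_mult ennreal_numeral)
  also have "\<dots> \<le> (\<integral>\<^sup>+z. ennreal (std_normal_density (z - (-1))) * ennreal ((g z - (-1))\<^sup>2) +
      ennreal (std_normal_density (z - 1)) * ennreal ((g z - 1)\<^sup>2) \<partial>lborel)"
  proof (rule nn_integral_mono)
    fix z :: real
    show "ennreal (2 * ?k) * indicator {-1..1} z \<le>
      ennreal (std_normal_density (z - (-1))) * ennreal ((g z - (-1))\<^sup>2) +
      ennreal (std_normal_density (z - 1)) * ennreal ((g z - 1)\<^sup>2)"
    proof (cases "z \<in> {-1..1}")
      case True
      have sq: "2 \<le> (g z - (-1))\<^sup>2 + (g z - 1)\<^sup>2"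
        by (simp add: power2_eq_square algebra_simps)
      have "2 * ?k \<le> ((g z - (-1))\<^sup>2 + (g z - 1)\<^sup>2) * ?k"
        by (intro mult_right_mono sq) simp
      also have "\<dots> = ?k * (g z - (-1))\<^sup>2 + ?k * (g z - 1)\<^sup>2"
        by (simp add: algebra_simps)
      also have "\<dots> \<le> std_normal_density (z - (-1)) * (g z - (-1))\<^sup>2 +
          std_normal_density (z - 1) * (g z - 1)\<^sup>2"
        using True by (intro add_mono mult_right_mono std_normal_density_ge) auto
      finally show ?thesis
        using True by (simp flip: ennreal_mult ennreal_plus)
    qed simp
  qed
  also have "\<dots> = (\<integral>\<^sup>+e. ennreal ((g (-1 + e) - (-1))\<^sup>2) \<partial>std_normal_distribution) +
      (\<integral>\<^sup>+e. ennreal ((g (1 + e) - 1)\<^sup>2) \<partial>std_normal_distribution)"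
    unfolding shift by (rule nn_integral_add) auto
  finally show ?thesis .
qed

section \<open>Coordinatewise risk\<close>

definition coord_risk ::
  "nat \<Rightarrow> nat \<Rightarrow> (((nat \<Rightarrow> nat) \<Rightarrow> real) \<Rightarrow> ((nat \<Rightarrow> nat) \<Rightarrow> real)) \<Rightarrow>
    ((nat \<Rightarrow> nat) \<Rightarrow> real) \<Rightarrow> (nat \<Rightarrow> nat) \<Rightarrow> ennreal" where
  "coord_risk d n1 T \<theta> w =
    (\<integral>\<^sup>+\<epsilon>. ennreal ((T (observation d n1 \<theta> \<epsilon>) w - \<theta> w)\<^sup>2) \<partial>noise d n1)"

lemma finite_lattice [simp]: "finite (lattice d n1)"
  by (auto simp: lattice_def intro: finite_PiE)

lemma estimator_coord_measurable:
  assumes "T \<in> estimators d n1" "w \<in> lattice d n1"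
  shows "(\<lambda>y. T y w) \<in> borel_measurable (data_space d n1)"
  using assms unfolding estimators_def data_space_def
  by (auto intro: measurable_compose[OF _ measurable_component_singleton])

lemma observation_measurable:
  "observation d n1 \<theta> \<in> noise d n1 \<rightarrow>\<^sub>M data_space d n1"
  unfolding observation_def[abs_def] noise_def data_space_def
proof (rule measurable_restrict)
  fix w assume w: "w \<in> lattice d n1"
  have "(\<lambda>\<epsilon>. \<epsilon> w) \<in> (\<Pi>\<^sub>M w\<in>lattice d n1. std_normal_distribution) \<rightarrow>\<^sub>M borel"
    by (rule measurable_compose[OF measurable_component_singleton[OF w]]) simp
  then show "(\<lambda>\<epsilon>. \<theta> w + \<epsilon> w) \<in> (\<Pi>\<^sub>M w\<in>lattice d n1. std_normal_distribution) \<rightarrow>\<^sub>M borel"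
    by simp
qed

lemma loss_coord_measurable:
  assumes "T \<in> estimators d n1" "w \<in> lattice d n1"
  shows "(\<lambda>\<epsilon>. ennreal ((T (observation d n1 \<theta> \<epsilon>) w - \<theta> w)\<^sup>2)) \<in> borel_measurable (noise d n1)"
  using measurable_compose[OF observation_measurable estimator_coord_measurable[OF assms]]
  by simp

lemma risk_eq_sum_coord_risk:
  assumes T: "T \<in> estimators d n1"
  shows "risk d n1 T \<theta> = ennreal (1 / real (n1 ^ d)) * (\<Sum>w\<in>lattice d n1. coord_risk d n1 T \<theta> w)"
proof -
  have "ennreal (1 / real (n1 ^ d) *
        (L2_set (\<lambda>w. T (observation d n1 \<theta> \<epsilon>) w - \<theta> w) (lattice d n1))\<^sup>2) =
      ennreal (1 / real (n1 ^ d)) *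
        (\<Sum>w\<in>lattice d n1. ennreal ((T (observation d n1 \<theta> \<epsilon>) w - \<theta> w)\<^sup>2))" for \<epsilon>
    by (simp only: L2_set_def real_sqrt_pow2 sum_nonneg zero_le_power2 sum_ennreal)
       (rule ennreal_mult, auto intro: sum_nonneg)
  then show ?thesis
    unfolding risk_def coord_risk_def
    by (simp only: nn_integral_cmult nn_integral_sum borel_measurable_sum
      loss_coord_measurable[OF T])
qed

text \<open>
  Conditionally on the noise away from \<open>w\<close>, the estimate at \<open>w\<close> is a function of the single
  observation at \<open>w\<close>, and it is the same function under both signals because they agree elsewhere.
  So the one-dimensional bound applies conditionally, and Fubini integrates it.
\<close>

lemma coord_risk_two_point:
  assumes T: "T \<in> estimators d n1" and w: "w \<in> lattice d n1"
    and \<theta>: "\<theta> w = -1" and \<theta>': "\<theta>' w = 1"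
    and agree: "\<And>v. v \<in> lattice d n1 \<Longrightarrow> v \<noteq> w \<Longrightarrow> \<theta> v = \<theta>' v"
  shows "ennreal (4 * std_normal_density 2) \<le> coord_risk d n1 T \<theta> w + coord_risk d n1 T \<theta>' w"
proof -
  let ?L = "lattice d n1" and ?N = "std_normal_distribution"
  let ?f = "\<lambda>\<theta> \<epsilon>. ennreal ((T (observation d n1 \<theta> \<epsilon>) w - \<theta> w)\<^sup>2)"
  interpret N: prob_space ?N
    by (rule prob_space_normal_density) simp
  interpret product_sigma_finite "\<lambda>_. ?N" ..
  let ?M = "Pi\<^sub>M (?L - {w}) (\<lambda>_. ?N)"
  interpret M: prob_space ?M
    by (rule prob_space_PiM) (rule N.prob_space_axioms)
  have ins: "insert w (?L - {w}) = ?L"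
    using w by blast
  have meas: "?f \<eta> \<in> borel_measurable (noise d n1)" for \<eta>
    by (rule loss_coord_measurable[OF T w])
  \<comment> \<open>The two losses are added before integrating, so that Fubini is applied only once and no
    measurability in the remaining coordinates has to be shown.\<close>
  have inner: "ennreal (4 * std_normal_density 2) \<le>
      (\<integral>\<^sup>+e. ?f \<theta> (x(w := e)) + ?f \<theta>' (x(w := e)) \<partial>?N)" if x: "x \<in> space ?M" for x
  proof -
    define g where "g y = T ((observation d n1 \<theta> x)(w := y)) w" for y
    \<comment> \<open>Here \<open>x\<close> is \<open>undefined\<close> at \<open>w\<close>, so the observation made from it is meaningless there;
      the update at \<open>w\<close> overwrites that value.\<close>
    have obs: "observation d n1 \<eta> (x(w := e)) = (observation d n1 \<theta> x)(w := \<eta> w + e)"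
      if "\<And>v. v \<in> ?L \<Longrightarrow> v \<noteq> w \<Longrightarrow> \<theta> v = \<eta> v" for \<eta> e
    proof
      fix v
      show "observation d n1 \<eta> (x(w := e)) v = ((observation d n1 \<theta> x)(w := \<eta> w + e)) v"
        using that[of v] w by (cases "v = w") (simp_all add: observation_def restrict_def)
    qed
    have "observation d n1 \<theta> x \<in> space (data_space d n1)"
      by (auto simp: observation_def data_space_def space_PiM)
    then have "(\<lambda>y. (observation d n1 \<theta> x)(w := y)) \<in> borel \<rightarrow>\<^sub>M data_space d n1"
      unfolding data_space_def using w
      by (intro measurable_fun_upd[where J = "?L"]) auto
    then have g [measurable]: "g \<in> borel_measurable borel"
      unfolding g_def[abs_def]
      by (rule measurable_compose) (rule estimator_coord_measurable[OF T w])
    have "(\<integral>\<^sup>+e. ?f \<theta> (x(w := e)) + ?f \<theta>' (x(w := e)) \<partial>?N) =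
        (\<integral>\<^sup>+e. ennreal ((g (-1 + e) - (-1))\<^sup>2) + ennreal ((g (1 + e) - 1)\<^sup>2) \<partial>?N)"
      using obs[of \<theta>] obs[of \<theta>'] agree by (simp add: g_def \<theta> \<theta>')
    also have "\<dots> = (\<integral>\<^sup>+e. ennreal ((g (-1 + e) - (-1))\<^sup>2) \<partial>?N) +
        (\<integral>\<^sup>+e. ennreal ((g (1 + e) - 1)\<^sup>2) \<partial>?N)"
      by (rule nn_integral_add) auto
    finally show ?thesis
      using two_point_normal[OF g] by simp
  qed
  have "ennreal (4 * std_normal_density 2) = (\<integral>\<^sup>+x. ennreal (4 * std_normal_density 2) \<partial>?M)"
    by (simp add: M.emeasure_space_1)
  also have "\<dots> \<le> (\<integral>\<^sup>+x. (\<integral>\<^sup>+e. ?f \<theta> (x(w := e)) + ?f \<theta>' (x(w := e)) \<partial>?N) \<partial>?M)"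
    by (rule nn_integral_mono) (rule inner)
  also have "\<dots> = (\<integral>\<^sup>+\<epsilon>. ?f \<theta> \<epsilon> + ?f \<theta>' \<epsilon> \<partial>noise d n1)"
    using product_nn_integral_insert[of "?L - {w}" w "\<lambda>\<epsilon>. ?f \<theta> \<epsilon> + ?f \<theta>' \<epsilon>"]
      borel_measurable_add[OF meas[of \<theta>] meas[of \<theta>']]
    unfolding ins by (simp add: noise_def)
  also have "\<dots> = coord_risk d n1 T \<theta> w + coord_risk d n1 T \<theta>' w"
    unfolding coord_risk_def by (rule nn_integral_add) (rule meas)+
  finally show ?thesis .
qed

section \<open>Antichains in the lattice and monotone signals\<close>

definition layer :: "nat \<Rightarrow> nat \<Rightarrow> nat \<Rightarrow> (nat \<Rightarrow> nat) set" where
  "layer d n1 s = {w \<in> lattice d n1. (\<Sum>j=1..d. w j) = s}"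

text \<open>
  The set \<open>A\<close> is meant to be a part of the layer with sum \<open>s\<close>, namely the points of the layer where the
  sign is positive. Indexing the cube by subsets rather than by sign vectors matches
  \<open>assouad_average\<close>.
\<close>

definition step_signal :: "nat \<Rightarrow> nat \<Rightarrow> nat \<Rightarrow> (nat \<Rightarrow> nat) set \<Rightarrow> (nat \<Rightarrow> nat) \<Rightarrow> real" where
  "step_signal d n1 s A = (\<lambda>w\<in>lattice d n1. if s < (\<Sum>j=1..d. w j) \<or> w \<in> A then 1 else -1)"

text \<open>
  The coordinate sum is strictly increasing along the order. In particular every layer is an
  antichain, and strictly comparable points lie in different layers.
\<close>

lemma coord_le_sum_eq:
  assumes u: "u \<in> lattice d n1" and v: "v \<in> lattice d n1" and le: "coord_le d u v"
    and sum: "(\<Sum>j=1..d. v j) \<le> (\<Sum>j=1..d. u j)"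
  shows "u = v"
proof (rule PiE_ext)
  show "u \<in> {1..d} \<rightarrow>\<^sub>E {1..n1}" "v \<in> {1..d} \<rightarrow>\<^sub>E {1..n1}"
    using u v by (auto simp: lattice_def)
  fix j assume j: "j \<in> {1..d}"
  show "u j = v j"
  proof (rule ccontr)
    assume "u j \<noteq> v j"
    then have "(\<Sum>j=1..d. u j) < (\<Sum>j=1..d. v j)"
      using le j by (intro sum_strict_mono_ex1) (auto simp: coord_le_def intro!: bexI[of _ j] le_neq_trans)
    with sum show False by simp
  qed
qed

text \<open>
  Along a strict inequality the coordinate sum grows, so at least one of the two points is off the
  layer: either the smaller one lies below it and has value \<open>-1\<close>, or the larger one lies above it
  and has value \<open>1\<close>.
\<close>

lemma step_signal_monotone:
  assumes A: "A \<subseteq> layer d n1 s"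
  shows "step_signal d n1 s A \<in> monotone_signals d n1 \<inter> sup_ball d n1 1"
proof -
  have "step_signal d n1 s A u \<le> step_signal d n1 s A v"
    if u: "u \<in> lattice d n1" and v: "v \<in> lattice d n1" and le: "coord_le d u v" for u v
  proof (cases "u = v")
    case False
    then have "(\<Sum>j=1..d. u j) < (\<Sum>j=1..d. v j)"
      using coord_le_sum_eq[OF u v le] by (meson not_le)
    then show ?thesis
      using A u v by (auto simp: step_signal_def layer_def)
  qed simp
  then show ?thesis
    by (auto simp: monotone_signals_def sup_ball_def step_signal_def)
qed

text \<open>
  Coordinate sums lie between \<open>d\<close> and \<open>d * n1\<close>. Counting them crudely as \<open>d * n1\<close> values
  loses only a constant factor.
\<close>

lemma large_layer:
  assumes d: "d \<ge> 1" and n1: "n1 \<ge> 1"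
  obtains s where "n1 ^ d \<le> card (layer d n1 s) * (d * n1)"
proof -
  have rng: "(\<Sum>j=1..d. w j) \<in> {1..d * n1}" if "w \<in> lattice d n1" for w
  proof -
    have w: "1 \<le> w j" "w j \<le> n1" if "j \<in> {1..d}" for j
      using \<open>w \<in> lattice d n1\<close> that by (auto simp: lattice_def PiE_iff)
    have "card {1..d} * 1 \<le> (\<Sum>j=1..d. w j)" "(\<Sum>j=1..d. w j) \<le> card {1..d} * n1"
      using sum_bounded_below[of "{1..d}" 1 w] sum_bounded_above[of "{1..d}" w n1] w by auto
    then show ?thesis
      using d by auto
  qed
  have "\<exists>s\<in>{1..d * n1}. card (lattice d n1) \<le>
      card ((\<lambda>w. \<Sum>j=1..d. w j) -` {s} \<inter> lattice d n1) * card {1..d * n1}"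
    using rng d n1 by (intro pigeonhole_card) auto
  then obtain s where "card (lattice d n1) \<le>
      card ((\<lambda>w. \<Sum>j=1..d. w j) -` {s} \<inter> lattice d n1) * (d * n1)"
    by auto
  moreover have "(\<lambda>w. \<Sum>j=1..d. w j) -` {s} \<inter> lattice d n1 = layer d n1 s"
    by (auto simp: layer_def)
  moreover have "card (lattice d n1) = n1 ^ d"
    by (simp add: lattice_def card_PiE)
  ultimately show thesis
    using that by simp
qed

section \<open>The minimax lower bound\<close>

text \<open>
  The constant: the layer makes up at least a fraction \<open>1 / (d * n1)\<close> of the lattice, and each of its
  points contributes on average half of the two-point bound \<open>4 * std_normal_density 2\<close>.
\<close>

lemma sup_risk_ge:
  assumes T: "T \<in> estimators d n1" and d: "d \<ge> 1" and n1: "n1 \<ge> 1"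
  shows "ennreal (2 * std_normal_density 2 / (real d * real n1)) \<le>
    (SUP \<theta>\<in>monotone_signals d n1 \<inter> sup_ball d n1 1. risk d n1 T \<theta>)"
    (is "_ \<le> ?S")
proof -
  obtain s where s: "n1 ^ d \<le> card (layer d n1 s) * (d * n1)"
    using large_layer[OF d n1] by blast
  let ?W = "layer d n1 s" and ?\<theta> = "step_signal d n1 s"
  let ?k = "4 * std_normal_density 2"
  let ?n = "ennreal (1 / real (n1 ^ d))"
  have WL: "?W \<subseteq> lattice d n1"
    by (auto simp: layer_def)
  have fin: "finite ?W"
    using WL finite_lattice by (rule finite_subset)
  have pair: "?n * ennreal ?k \<le>
      ?n * coord_risk d n1 T (?\<theta> A) w + ?n * coord_risk d n1 T (?\<theta> (insert w A)) w"
    if w: "w \<in> ?W" and A: "A \<subseteq> ?W - {w}" for w A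
    unfolding distrib_left[symmetric]
    using w A by (intro mult_left_mono coord_risk_two_point T) (auto simp: layer_def step_signal_def)
  have bound: "(\<Sum>w\<in>?W. ?n * coord_risk d n1 T (?\<theta> A) w) \<le> ?S" if A: "A \<subseteq> ?W" for A
  proof -
    have "(\<Sum>w\<in>?W. ?n * coord_risk d n1 T (?\<theta> A) w) =
        ?n * (\<Sum>w\<in>?W. coord_risk d n1 T (?\<theta> A) w)"
      by (rule sum_distrib_left[symmetric])
    also have "\<dots> \<le> ?n * (\<Sum>w\<in>lattice d n1. coord_risk d n1 T (?\<theta> A) w)"
      using WL by (intro mult_left_mono sum_mono2) auto
    also have "\<dots> = risk d n1 T (?\<theta> A)"
      by (rule risk_eq_sum_coord_risk[OF T, symmetric])
    also have "\<dots> \<le> ?S"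
      by (rule SUP_upper) (rule step_signal_monotone[OF A])
    finally show ?thesis .
  qed
  have "real n1 ^ d \<le> real (card ?W) * (real d * real n1)"
    using s by (metis of_nat_le_iff of_nat_mult of_nat_power)
  then have frac: "1 / (real d * real n1) \<le> real (card ?W) / real n1 ^ d"
    using d n1 by (simp add: field_simps)
  have "2 * ennreal (2 * std_normal_density 2 / (real d * real n1)) =
      ennreal (?k * (1 / (real d * real n1)))"
    by (simp flip: ennreal_mult ennreal_numeral)
  also have "\<dots> \<le> ennreal (?k * (real (card ?W) / real n1 ^ d))"
    by (intro ennreal_leI mult_left_mono frac) simp
  also have "\<dots> = of_nat (card ?W) * (?n * ennreal ?k)"
    by (simp add: ennreal_of_nat_eq_real_of_nat mult_ac flip: ennreal_mult)
  also have "\<dots> \<le> 2 * ?S"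
    by (rule assouad_average[OF fin pair bound])
  finally show ?thesis
    by (simp add: ennreal_mult_le_mult_iff)
qed

theorem proposition1:
  fixes d :: nat
  assumes "d \<ge> 2"
  shows "\<exists>c>0::real. \<forall>n n1 :: nat. n \<ge> 2 \<longrightarrow> n = n1 ^ d \<longrightarrow>
    (INF T\<in>estimators d n1. SUP \<theta>\<in>monotone_signals d n1 \<inter> sup_ball d n1 1. risk d n1 T \<theta>)
      \<ge> ennreal (c * real n powr (- 1 / real d))"
proof (intro exI[of _ "2 * std_normal_density 2 / real d"] conjI allI impI)
  show "2 * std_normal_density 2 / real d > 0"
    using assms by (simp add: normal_density_pos)
next
  fix n n1 :: nat
  assume n: "n \<ge> 2" "n = n1 ^ d"
  have n1: "n1 \<ge> 1"
    using n assms by (cases n1) (auto simp: zero_power)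
  have "real n powr (- 1 / real d) = (real n1 powr real d) powr (- 1 / real d)"
    using n n1 by (simp add: powr_realpow)
  also have "\<dots> = 1 / real n1"
    using assms n1 by (simp add: powr_powr powr_minus_divide)
  finally have eq: "2 * std_normal_density 2 / real d * real n powr (- 1 / real d) =
      2 * std_normal_density 2 / (real d * real n1)"
    by simp
  show "ennreal (2 * std_normal_density 2 / real d * real n powr (- 1 / real d)) \<le>
    (INF T\<in>estimators d n1. SUP \<theta>\<in>monotone_signals d n1 \<inter> sup_ball d n1 1. risk d n1 T \<theta>)"
    unfolding eq using assms n1 by (intro INF_greatest sup_risk_ge) auto
qed

end
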